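(* Let $m,n\ge1$ be integers, let $q>1$, let $1<p_1,\dots,p_m<\infty$, let $p$ be given by $\frac1p=\sum_{i=1}^m\frac1{p_i}$, and suppose that $\left(\frac1{p_1},\dots,\frac1{p_m}\right)\notin\mathcal H^m(q)$. Then there exist an odd function $\Omega\in L^q(\mathbb S^{mn-1})$ and functions $f_i\in L^{p_i}(\mathbb R^n)$, $i=1,\dots,m$, such that $T^m_\Omega(f_1,\dots,f_m)\notin L^p(\mathbb R^n)$.
   Context: $\mathbb S^{mn-1}$ is the unit sphere of $\mathbb R^{mn}=(\mathbb R^n)^m$, equipped with surface measure; $\Omega$ is odd if $\Omega(-\theta)=-\Omega(\theta)$. For an integrable function $\Omega$ on $\mathbb S^{mn-1}$ with vanishing integral, let $K(y)=\Omega(y/|y|)\,|y|^{-mn}$ for $y\in\mathbb R^{mn}\setminus\{0\}$, and define $$T^m_\Omega(f_1,\dots,f_m)(x)=\mathrm{p.v.}\int_{\mathbb R^{mn}}K(x-y_1,\dots,x-y_m)\prod_{i=1}^mf_i(y_i)\,dy_1\cdots dy_m,$$ where the principal value is the limit as $\epsilon\to0^+$ of the integral over $|(x-y_1,\dots,x-y_m)|>\epsilon$. At points $x$ where the integrand is nonnegative the value is understood in $[0,\infty]$. The assertion $T^m_\Omega(f_1,\dots,f_m)\notin L^p(\mathbb R^n)$ means that it is not the case that this expression exists and is finite for almost every $x$ and defines a function in $L^p(\mathbb R^n)$. For $\alpha\in\{0,1\}^m$ write $|\alpha|=\sum_{i=1}^m\alpha_i$ and $\frac1{p_\alpha}=\sum_{i=1}^m\frac{\alpha_i}{p_i}$.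 For $q>1$, the condition $\left(\frac1{p_1},\dots,\frac1{p_m}\right)\in\mathcal H^m(q)$ means that for all $\alpha\in\{0,1\}^m$, $$\frac1{p_\alpha}+\frac{|\alpha|-1}{q}<|\alpha| .$$ *)

theory Defs
  imports "HOL-Analysis.Analysis"
begin

text \<open>
  Surface measure on the unit sphere, in polar-coordinate form: the measure of a Borel set
  \<open>A\<close> is the dimension times the volume of the cone \<open>{x. 0 < norm x \<le> 1, x / norm x \<in> A}\<close>.
  In dimension one it is counting measure on \<open>{-1, 1}\<close>.
\<close>

definition sphere_measure :: "'a::euclidean_space measure" where
  "sphere_measure =
     scale_measure (of_nat DIM('a))
       (distr (restrict_space lborel (cball 0 1 - {0})) (restrict_space borel (sphere 0 1))
          (\<lambda>x. x /\<^sub>R norm x))"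

lemma space_sphere_measure: "space sphere_measure = sphere 0 1"
  by (simp add: sphere_measure_def space_scale_measure space_restrict_space)

lemma sets_sphere_measure: "sets sphere_measure = sets (restrict_space borel (sphere 0 1))"
  by (simp add: sphere_measure_def)

lemma emeasure_sphere_measure:
  fixes A :: "'a::euclidean_space set"
  assumes "A \<in> sets borel" "A \<subseteq> sphere 0 1"
  shows "emeasure sphere_measure A =
    of_nat DIM('a) * emeasure lborel {x. x \<noteq> 0 \<and> norm x \<le> 1 \<and> x /\<^sub>R norm x \<in> A}"
proof -
  let ?B = "cball 0 1 - {0} :: 'a set"
  let ?M = "restrict_space lborel ?B"
  have m: "(\<lambda>x. x /\<^sub>R norm x) \<in> measurable ?M (restrict_space borel (sphere 0 1))"
    by (rule measurable_restrict_space2)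
       (auto simp: space_restrict_space intro!: measurable_restrict_space1)
  have A: "A \<in> sets (restrict_space borel (sphere 0 1))"
    using assms by (auto simp: sets_restrict_space)
  have eq: "(\<lambda>x. x /\<^sub>R norm x) -` A \<inter> space ?M =
      {x. x \<noteq> 0 \<and> norm x \<le> 1 \<and> x /\<^sub>R norm x \<in> A}"
    by (auto simp: space_restrict_space)
  have "emeasure ?M ((\<lambda>x. x /\<^sub>R norm x) -` A \<inter> space ?M) =
      emeasure lborel ((\<lambda>x. x /\<^sub>R norm x) -` A \<inter> space ?M)"
    by (rule emeasure_restrict_space) (auto simp: space_restrict_space)
  then show ?thesis
    unfolding sphere_measure_def emeasure_scale_measure emeasure_distr[OF m A] eq
    by simp
qed

text \<open>Real-valued members of \<open>L\<^sup>p\<close>; the exponent may be any positive real, also below 1.\<close>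

definition in_Lp :: "'a measure \<Rightarrow> real \<Rightarrow> ('a \<Rightarrow> real) \<Rightarrow> bool" where
  "in_Lp M p f \<longleftrightarrow> f \<in> borel_measurable M \<and> integrable M (\<lambda>x. \<bar>f x\<bar> powr p)"

definition odd_on_sphere :: "('a::euclidean_space \<Rightarrow> real) \<Rightarrow> bool" where
  "odd_on_sphere \<Omega> \<longleftrightarrow> (\<forall>\<theta>\<in>sphere 0 1. \<Omega> (- \<theta>) = - \<Omega> \<theta>)"

text \<open>
  \<open>(\<real>\<^sup>n)\<^sup>m\<close> is the type \<open>real ^ 'n ^ 'm\<close>; its library norm is the Euclidean norm of \<open>\<real>\<^bsup>mn\<^esup>\<close>.
\<close>

definition rough_kernel :: "(real ^ 'n ^ 'm \<Rightarrow> real) \<Rightarrow> real ^ 'n ^ 'm \<Rightarrow> real" where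
  "rough_kernel \<Omega> y = \<Omega> (y /\<^sub>R norm y) / norm y ^ (CARD('m) * CARD('n))"

definition T_integrand ::
  "(real ^ 'n ^ 'm \<Rightarrow> real) \<Rightarrow> ('m \<Rightarrow> real ^ 'n \<Rightarrow> real) \<Rightarrow> real ^ 'n \<Rightarrow> real ^ 'n ^ 'm \<Rightarrow> real"
where
  "T_integrand \<Omega> f x y = rough_kernel \<Omega> (\<chi> i. x - y $ i) * (\<Prod>i\<in>UNIV. f i (y $ i))"

text \<open>
  \<open>has_truncated_T \<Omega> f x \<epsilon> v\<close>: the integral over \<open>|(x - y\<^sub>1, \<dots>, x - y\<^sub>m)| > \<epsilon>\<close> exists with value
  \<open>v\<close>, either as an absolutely convergent integral, or, when the integrand is nonnegative, as an
  integral in \<open>[0, \<infinity>]\<close>.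
\<close>

definition has_truncated_T ::
  "(real ^ 'n ^ 'm \<Rightarrow> real) \<Rightarrow> ('m \<Rightarrow> real ^ 'n \<Rightarrow> real) \<Rightarrow> real ^ 'n \<Rightarrow> real \<Rightarrow> ereal \<Rightarrow> bool"
where
  "has_truncated_T \<Omega> f x \<epsilon> v \<longleftrightarrow>
     (let D = {y. norm (\<chi> i. x - y $ i) > \<epsilon>} in
       (set_integrable lborel D (T_integrand \<Omega> f x) \<and>
          v = ereal (set_lebesgue_integral lborel D (T_integrand \<Omega> f x))) \<or>
       (T_integrand \<Omega> f x \<in> borel_measurable lborel \<and>
          (AE y in lborel. T_integrand \<Omega> f x y \<ge> 0) \<and>
          v = enn2ereal (set_nn_integral lborel D (\<lambda>y. ennreal (T_integrand \<Omega> f x y)))))"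

definition has_T_value ::
  "(real ^ 'n ^ 'm \<Rightarrow> real) \<Rightarrow> ('m \<Rightarrow> real ^ 'n \<Rightarrow> real) \<Rightarrow> real ^ 'n \<Rightarrow> ereal \<Rightarrow> bool"
where
  "has_T_value \<Omega> f x v \<longleftrightarrow>
     (\<exists>I. (\<forall>\<epsilon>>0. has_truncated_T \<Omega> f x \<epsilon> (I \<epsilon>)) \<and> (I \<longlongrightarrow> v) (at_right 0))"

definition T_in_Lp ::
  "(real ^ 'n ^ 'm \<Rightarrow> real) \<Rightarrow> ('m \<Rightarrow> real ^ 'n \<Rightarrow> real) \<Rightarrow> real \<Rightarrow> bool"
where
  "T_in_Lp \<Omega> f p \<longleftrightarrow>
     (\<exists>g. in_Lp lborel p g \<and> (AE x in lborel. has_T_value \<Omega> f x (ereal (g x))))"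

definition H_region :: "real \<Rightarrow> (real ^ 'm) set" where
  "H_region q =
     {t. \<forall>\<alpha> :: 'm \<Rightarrow> nat. (\<forall>i. \<alpha> i \<in> {0, 1}) \<longrightarrow>
           (\<Sum>i\<in>UNIV. real (\<alpha> i) * t $ i) + (real (\<Sum>i\<in>UNIV. \<alpha> i) - 1) / q
             < real (\<Sum>i\<in>UNIV. \<alpha> i)}"

end

theory Submission
  imports Defs
begin

text \<open>
  Why boundedness fails outside \<open>\<H>\<^sup>m(q)\<close>. Let \<open>S\<close> be the support of an \<open>\<alpha>\<close> whose inequality
  fails and let \<open>k = |S|\<close>. Since every \<open>p\<^sub>i\<close> and \<open>q\<close> exceed 1, this forces \<open>k \<ge> 2\<close>. Take \<open>f\<^sub>i\<close> to be
  the indicator of the cube \<open>[-1,1]\<^sup>n\<close> for \<open>i \<in> S\<close>. Seen from a point \<open>x\<close> at distance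
  about \<open>R = 2\<^sup>j\<close>, these cubes make the direction of \<open>(x - y\<^sub>1, \<dots>, x - y\<^sub>m)\<close> lie within about \<open>1/R\<close> of the
  diagonal \<open>{\<theta>. \<theta>\<^sub>i = \<theta>\<^sub>l for i, l \<in> S}\<close>, which has codimension \<open>(k-1)n\<close>. A function in \<open>L\<^sup>q\<close> may have
  size about \<open>R\<close> to the power \<open>(k-1)n/q\<close> there. For \<open>i \<notin> S\<close> the functions \<open>f\<^sub>i\<close> decay like
  \<open>|y|\<close> to the power \<open>-n/p\<^sub>i\<close>, so that all scales contribute. With \<open>B\<close> the sum of \<open>1/p\<^sub>i\<close>
  over \<open>i \<notin> S\<close>, the value of \<open>T\<close> on a cube of side \<open>R\<close> at distance about \<open>R\<close> from the origin is at
  least a constant times \<open>R\<close> to the power \<open>n((k-1)/q - k - B)\<close>. The failing inequality says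
  precisely that this exponent is at least \<open>-n/p\<close>, so without further corrections every dyadic
  scale would contribute at least a fixed amount to the integral of \<open>|T|\<^sup>p\<close>.

  Integrability with the exponents \<open>q\<close> and \<open>p\<^sub>i\<close> costs a power of the scale index \<open>j\<close>: \<open>\<Omega>\<close> up to its sign
  (with \<open>r = q\<close>) and \<open>f\<^sub>i\<close> for \<open>i \<notin> S\<close> (with \<open>r = p\<^sub>i\<close>) are each the
  \<open>r\<close>-th root of a series over dyadic scales with coefficients \<open>w\<^sub>j = (j+1)\<close> to the power \<open>-s\<close>, where
  \<open>s > 1\<close> makes the series of \<open>r\<close>-th powers integrable. The scale \<open>j\<close> then contributes at least a
  constant times \<open>w\<^sub>j\<close> to the power \<open>p(1/q + B)\<close>. As \<open>p\<^sub>i, q > 1\<close>, the failing inequality also gives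
  \<open>\<Sum>\<^sub>S 1/p\<^sub>i \<ge> 1 > 1/q\<close>, that is \<open>1/q + B < 1/p\<close>. This leaves room for the choice
  \<open>s = 1 / (p(1/q + B)) > 1\<close>, for which the contributions add up to a harmonic series. So the
  argument covers the endpoint case of equality as well.

  The factor \<open>sgn (\<theta> $ i\<^sub>0 $ c\<^sub>0)\<close> with \<open>i\<^sub>0 \<in> S\<close> makes \<open>\<Omega>\<close> odd without creating cancellation: if all
  coordinates of \<open>x\<close> are at least 2 and \<open>y\<^sub>i\<^sub>0\<close> lies in the support of \<open>f\<^sub>i\<^sub>0\<close>, then \<open>x - y\<^sub>i\<^sub>0\<close> has
  positive coordinates. The integrand is therefore nonnegative at the points \<open>x\<close> that matter, and the
  principal value is bounded below by the integral over any set away from the singularity.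

  The size of \<open>\<Omega>\<close> is controlled by \<open>emeasure_near_diagonal_le\<close>, the pointwise lower bound for \<open>T\<close> is
  \<open>T_value_ge\<close>, and \<open>summable_of_in_Lp\<close> turns an \<open>L\<^sup>p\<close> bound into the convergence of a series.
\<close>

section \<open>Roots of series over scales\<close>

text \<open>
  Summing inside the root lets the integral of the \<open>r\<close>-th power be computed term by term for
  every \<open>r\<close>. The sum is formed in \<open>[0, \<infinity>]\<close>, which makes it measurable without a
  convergence assumption; at points of divergence the resulting value is 0.
\<close>

definition root_series :: "real \<Rightarrow> (nat \<Rightarrow> real) \<Rightarrow> (nat \<Rightarrow> 'a set) \<Rightarrow> 'a \<Rightarrow> real" where
  "root_series r a A x = enn2real (\<Sum>j. ennreal (a j) * indicator (A j) x) powr (1 / r)"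

lemma root_series_nonneg: "0 \<le> root_series r a A x"
  by (simp add: root_series_def)

lemma root_series_measurable [measurable]:
  assumes [measurable]: "\<And>j. A j \<in> sets M"
  shows "root_series r a A \<in> borel_measurable M"
  unfolding root_series_def by measurable

lemma in_Lp_root_series:
  assumes [measurable]: "\<And>j. A j \<in> sets M" and "0 < r"
    and fin: "(\<Sum>j. ennreal (a j) * emeasure M (A j)) < \<infinity>"
  shows "in_Lp M r (root_series r a A)"
proof -
  have eq: "\<bar>root_series r a A x\<bar> powr r
      = enn2real (\<Sum>j. ennreal (a j) * indicator (A j) x)" for x
    using \<open>0 < r\<close> by (simp add: root_series_def powr_powr enn2real_nonneg)
  have "(\<integral>\<^sup>+x. ennreal (norm (enn2real (\<Sum>j. ennreal (a j) * indicator (A j) x))) \<partial>M)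
      \<le> (\<integral>\<^sup>+x. (\<Sum>j. ennreal (a j) * indicator (A j) x) \<partial>M)"
    by (intro nn_integral_mono) (simp add: ennreal_enn2real_if)
  also have "\<dots> = (\<Sum>j. \<integral>\<^sup>+x. ennreal (a j) * indicator (A j) x \<partial>M)"
    by (intro nn_integral_suminf) measurable
  also have "\<dots> = (\<Sum>j. ennreal (a j) * emeasure M (A j))"
    by (simp add: nn_integral_cmult_indicator)
  finally have "integrable M (\<lambda>x. enn2real (\<Sum>j. ennreal (a j) * indicator (A j) x))"
    using fin by (intro integrableI_bounded) (auto intro: le_less_trans)
  then show ?thesis
    unfolding in_Lp_def by (simp add: eq)
qed

text \<open>
  This is how a series with many overlapping terms is bounded below: one term suffices, provided
  the sum at the point is finite, since otherwise the value is the default 0.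
\<close>

lemma root_series_ge:
  assumes "x \<in> A j" "0 < r" "0 \<le> a j"
    and fin: "(\<Sum>j. ennreal (a j) * indicator (A j) x) < \<infinity>"
  shows "a j powr (1 / r) \<le> root_series r a A x"
proof -
  have "ennreal (a j) = ennreal (a j) * indicator (A j) x" using assms by simp
  also have "\<dots> = (\<Sum>i\<in>{j}. ennreal (a i) * indicator (A i) x)"
    by (simp del: sum_mult_indicator)
  also have "\<dots> \<le> (\<Sum>j. ennreal (a j) * indicator (A j) x)"
    by (intro sum_le_suminf) auto
  finally have "enn2real (ennreal (a j)) \<le> enn2real (\<Sum>j. ennreal (a j) * indicator (A j) x)"
    using fin by (intro enn2real_mono) auto
  then show ?thesis
    unfolding root_series_def using assms by (intro powr_mono2) auto
qed

lemma in_Lp_dominated: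
  assumes "in_Lp M r g" "f \<in> borel_measurable M" "\<And>x. \<bar>f x\<bar> \<le> \<bar>g x\<bar>" "0 \<le> r"
  shows "in_Lp M r f"
proof -
  have "integrable M (\<lambda>x. \<bar>f x\<bar> powr r)"
  proof (rule Bochner_Integration.integrable_bound)
    show "integrable M (\<lambda>x. \<bar>g x\<bar> powr r)" using assms by (simp add: in_Lp_def)
    show "(\<lambda>x. \<bar>f x\<bar> powr r) \<in> borel_measurable M" using assms by measurable
    show "AE x in M. norm (\<bar>f x\<bar> powr r) \<le> norm (\<bar>g x\<bar> powr r)"
      using assms by (auto intro!: powr_mono2)
  qed
  then show ?thesis using assms by (simp add: in_Lp_def)
qed

section \<open>Volume of neighbourhoods of a diagonal\<close>

lemma prod_Basis_blocks:
  "(\<Prod>b\<in>(Basis :: (real ^ 'n ^ 'm) set). h b) = (\<Prod>i\<in>UNIV. \<Prod>c\<in>UNIV. h (axis i (axis c 1)))"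
proof -
  have "(\<Prod>b\<in>(Basis :: (real ^ 'n ^ 'm) set). h b)
      = (\<Prod>x\<in>(UNIV :: ('m \<times> 'n) set). h (axis (fst x) (axis (snd x) 1)))"
  proof (rule prod.reindex_cong[of "\<lambda>x. axis (fst x) (axis (snd x) 1)"])
    show "inj_on (\<lambda>x::'m \<times> 'n. axis (fst x) (axis (snd x) (1::real))) UNIV"
      by (auto simp: inj_on_def axis_eq_axis)
    show "(Basis :: (real ^ 'n ^ 'm) set) = range (\<lambda>x. axis (fst x) (axis (snd x) 1))"
      by (fastforce simp: Basis_vec_def image_iff)
  qed simp
  then show ?thesis
    by (simp add: prod.cartesian_product case_prod_unfold)
qed

lemma mem_cbox_blocks:
  fixes y l u :: "real ^ 'n ^ 'm"
  shows "y \<in> cbox l u \<longleftrightarrow> (\<forall>i c. l $ i $ c \<le> y $ i $ c \<and> y $ i $ c \<le> u $ i $ c)"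
  by (auto simp: mem_box Basis_vec_def inner_axis)

lemma emeasure_cbox_blocks:
  fixes l u :: "real ^ 'n ^ 'm"
  assumes "\<And>i c. l $ i $ c \<le> u $ i $ c"
  shows "emeasure lborel (cbox l u) = ennreal (\<Prod>i\<in>UNIV. \<Prod>c\<in>UNIV. u $ i $ c - l $ i $ c)"
proof -
  have "emeasure lborel (cbox l u) = ennreal (\<Prod>b\<in>Basis. (u - l) \<bullet> b)"
    by (rule emeasure_lborel_cbox) (use assms in \<open>auto simp: Basis_vec_def inner_axis\<close>)
  then show ?thesis
    by (simp add: prod_Basis_blocks inner_axis)
qed

lemma emeasure_cbox_vec:
  fixes l u :: "real ^ 'n"
  assumes "\<And>c. l $ c \<le> u $ c"
  shows "emeasure lborel (cbox l u) = ennreal (\<Prod>c\<in>UNIV. u $ c - l $ c)"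
proof -
  have "cbox l u \<noteq> {}" using assms by (auto simp: box_ne_empty Basis_vec_def inner_axis)
  then show ?thesis
    using emeasure_eq_ennreal_measure[of lborel "cbox l u"] emeasure_lborel_cbox_finite[of l u]
    by (simp add: content_cbox_cart)
qed

text \<open>
  A neighbourhood of the diagonal on which the blocks indexed by \<open>S\<close> coincide. Comparing with one
  fixed block \<open>i\<^sub>0\<close> describes it up to a factor 2, and coordinatewise comparison keeps
  everything a box when block \<open>i\<^sub>0\<close> is held fixed.
\<close>

definition near_diagonal :: "'m set \<Rightarrow> 'm \<Rightarrow> real \<Rightarrow> (real ^ 'n ^ 'm) set" where
  "near_diagonal S i\<^sub>0 \<delta> = {z. \<forall>i\<in>S. \<forall>c. \<bar>z $ i $ c - z $ i\<^sub>0 $ c\<bar> \<le> \<delta>}"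

lemma closed_near_diagonal: "closed (near_diagonal S i\<^sub>0 \<delta> :: (real ^ 'n ^ 'm) set)"
  unfolding near_diagonal_def Ball_def
  by (intro closed_Collect_all closed_Collect_imp closed_Collect_le open_Collect_const continuous_intros)

text \<open>
  The neighbourhood is a slanted tube, and averaging over a parameter \<open>t \<in> \<real>\<^sup>n\<close> replaces it by
  axis-parallel boxes. For each \<open>z\<close> in the tube, the points \<open>t\<close> within \<open>\<delta>\<close> of the block \<open>z\<^sub>i\<^sub>0\<close>
  have volume \<open>(2\<delta>)\<^sup>n\<close>. For each \<open>t\<close>, the points \<open>z\<close> of the tube related to it lie in a box whose \<open>k\<close> blocks in
  \<open>S\<close> have side \<open>4\<delta>\<close>, and only \<open>t \<in> [-3,3]\<^sup>n\<close> occur. Tonelli's theorem compares the two counts,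
  and the power of \<open>\<delta>\<close> that remains is the codimension \<open>(k-1)n\<close>.
\<close>

lemma emeasure_near_diagonal_le:
  assumes "i\<^sub>0 \<in> S" "0 < \<delta>" "\<delta> \<le> 2"
  shows "emeasure lborel (cbox (\<chi> i c. -1) (\<chi> i c. 1) \<inter> near_diagonal S i\<^sub>0 \<delta> :: (real ^ 'n ^ 'm) set)
    \<le> ennreal (3 ^ CARD('n) * 4 ^ (CARD('m) * CARD('n)) * \<delta> ^ ((card S - 1) * CARD('n)))"
    (is "emeasure lborel ?W \<le> ennreal (_ * _ * \<delta> ^ (_ * ?n))")
proof -
  let ?k = "card S"
  have k: "?k = Suc (?k - 1)" using assms(1) by (metis One_nat_def Suc_pred card_gt_0_iff empty_iff finite)
  have W: "closed ?W" by (intro closed_Int closed_cbox closed_near_diagonal)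
  define D :: "((real ^ 'n) \<times> (real ^ 'n ^ 'm)) set"
    where "D = {(t, z). z \<in> ?W \<and> (\<forall>c. \<bar>t $ c - z $ i\<^sub>0 $ c\<bar> \<le> \<delta>)}"
  have Deq: "D = snd -` ?W \<inter> {p. \<forall>c. \<bar>fst p $ c - snd p $ i\<^sub>0 $ c\<bar> \<le> \<delta>}"
    by (auto simp: D_def)
  have "closed D" unfolding Deq
    by (intro closed_Int closed_vimage W continuous_intros closed_Collect_all closed_Collect_le)
  then have "D \<in> sets borel" by (rule borel_closed)
  then have "D \<in> sets (lborel \<Otimes>\<^sub>M lborel)"
    by (metis lborel_prod sets_lborel)
  then have D: "(\<lambda>(t, z). indicator D (t, z) :: ennreal)
      \<in> borel_measurable (lborel \<Otimes>\<^sub>M lborel)"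
    by simp
  have inner_t: "(\<integral>\<^sup>+t. indicator D (t, z) \<partial>lborel) = ennreal ((2 * \<delta>) ^ ?n) * indicator ?W z" for z
  proof -
    let ?Q = "cbox (\<chi> c. z $ i\<^sub>0 $ c - \<delta>) (\<chi> c. z $ i\<^sub>0 $ c + \<delta>) :: (real ^ 'n) set"
    have "indicator D (t, z) = (indicator ?W z * indicator ?Q t :: ennreal)" for t
      by (auto simp: D_def indicator_def mem_box_cart abs_le_iff algebra_simps)
    moreover have "emeasure lborel ?Q = ennreal ((2 * \<delta>) ^ ?n)"
      using assms by (subst emeasure_cbox_vec) auto
    ultimately show ?thesis
      by (simp add: nn_integral_cmult_indicator mult.commute)
  qed
  have inner_z: "(\<integral>\<^sup>+z. indicator D (t, z) \<partial>lborel)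
      \<le> ennreal (4 ^ (CARD('m) * ?n) * \<delta> ^ (?k * ?n)) * indicator (cbox (\<chi> c. -3) (\<chi> c. 3)) t" for t
  proof -
    let ?l = "(\<chi> i c. if i \<in> S then t $ c - 2 * \<delta> else -1) :: real ^ 'n ^ 'm"
    let ?u = "(\<chi> i c. if i \<in> S then t $ c + 2 * \<delta> else 1) :: real ^ 'n ^ 'm"
    have le: "indicator D (t, z)
        \<le> (indicator (cbox (\<chi> c. -3) (\<chi> c. 3)) t * indicator (cbox ?l ?u) z :: ennreal)" for z
    proof (cases "(t, z) \<in> D")
      case True
      then have z: "\<bar>t $ c - z $ i\<^sub>0 $ c\<bar> \<le> \<delta>" "-1 \<le> z $ i $ c" "z $ i $ c \<le> 1"
        "i \<in> S \<Longrightarrow> \<bar>z $ i $ c - z $ i\<^sub>0 $ c\<bar> \<le> \<delta>" for i c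
        by (auto simp: D_def near_diagonal_def mem_cbox_blocks)
      have "t \<in> cbox (\<chi> c. -3) (\<chi> c. 3)"
      proof (simp add: mem_box_cart, intro allI)
        fix c show "- 3 \<le> t $ c \<and> t $ c \<le> 3"
          using z(1)[of c] z(2,3)[of i\<^sub>0 c] \<open>\<delta> \<le> 2\<close> by linarith
      qed
      moreover have "z \<in> cbox ?l ?u"
      proof (simp add: mem_cbox_blocks z, intro allI impI)
        fix i c assume "i \<in> S" then show "t $ c - 2 * \<delta> \<le> z $ i $ c \<and> z $ i $ c \<le> t $ c + 2 * \<delta>"
          using z(1)[of c] z(4)[of i c] by linarith
      qed
      ultimately show ?thesis by (simp add: indicator_def)
    qed simp
    have "emeasure lborel (cbox ?l ?u)
        = ennreal (\<Prod>i\<in>UNIV. \<Prod>c\<in>(UNIV :: 'n set). if i \<in> S then 4 * \<delta> else 2)"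
      using assms by (subst emeasure_cbox_blocks) (auto intro!: arg_cong[of _ _ ennreal] prod.cong)
    also have "\<dots> \<le> ennreal (\<Prod>i\<in>(UNIV :: 'm set). 4 ^ ?n * (if i \<in> S then \<delta> ^ ?n else 1))"
      using assms by (intro ennreal_leI prod_mono) (auto simp: power_mult_distrib power_mono)
    also have "(\<Prod>i\<in>(UNIV :: 'm set). 4 ^ ?n * (if i \<in> S then \<delta> ^ ?n else 1))
        = 4 ^ (CARD('m) * ?n) * \<delta> ^ (?k * ?n)"
      by (simp add: prod.distrib power_mult[symmetric] mult.commute flip: prod.inter_filter)
    finally have vol: "emeasure lborel (cbox ?l ?u)
        \<le> ennreal (4 ^ (CARD('m) * ?n) * \<delta> ^ (?k * ?n))" .
    have "(\<integral>\<^sup>+z. indicator D (t, z) \<partial>lborel)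
      \<le> (\<integral>\<^sup>+z. indicator (cbox (\<chi> c. -3) (\<chi> c. 3)) t * indicator (cbox ?l ?u) z \<partial>lborel)"
      by (intro nn_integral_mono le)
    also have "\<dots> = indicator (cbox (\<chi> c. -3) (\<chi> c. 3)) t * emeasure lborel (cbox ?l ?u)"
      by (simp add: nn_integral_cmult_indicator)
    also have "\<dots> \<le> indicator (cbox (\<chi> c. -3) (\<chi> c. 3)) t
        * ennreal (4 ^ (CARD('m) * ?n) * \<delta> ^ (?k * ?n))"
      by (intro mult_left_mono vol) simp
    finally show ?thesis by (simp add: mult.commute)
  qed
  have "ennreal ((2 * \<delta>) ^ ?n) * emeasure lborel ?W
      = (\<integral>\<^sup>+z. (\<integral>\<^sup>+t. indicator D (t, z) \<partial>lborel) \<partial>lborel)"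
    using W by (simp add: inner_t nn_integral_cmult_indicator)
  also have "\<dots> = (\<integral>\<^sup>+t. (\<integral>\<^sup>+z. indicator D (t, z) \<partial>lborel) \<partial>lborel)"
    using D by (rule lborel_pair.Fubini')
  also have "\<dots> \<le> (\<integral>\<^sup>+t. ennreal (4 ^ (CARD('m) * ?n) * \<delta> ^ (?k * ?n))
      * indicator (cbox (\<chi> c. -3) (\<chi> c. 3)) (t :: real ^ 'n) \<partial>lborel)"
    by (intro nn_integral_mono inner_z)
  also have "\<dots> = ennreal (4 ^ (CARD('m) * ?n) * \<delta> ^ (?k * ?n)) * ennreal (6 ^ ?n)"
    by (subst nn_integral_cmult_indicator) (simp_all add: emeasure_cbox_vec)
  also have "\<dots> = ennreal ((2 * \<delta>) ^ ?n)
      * ennreal (3 ^ ?n * 4 ^ (CARD('m) * ?n) * \<delta> ^ ((?k - 1) * ?n))"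
  proof -
    have "\<delta> ^ (?k * ?n) = \<delta> ^ ?n * \<delta> ^ ((?k - 1) * ?n)"
      by (subst k) (simp add: power_add)
    moreover have "(6::real) ^ ?n = 2 ^ ?n * 3 ^ ?n"
      by (simp flip: power_mult_distrib)
    ultimately show ?thesis
      using assms by (simp add: power_mult_distrib flip: ennreal_mult')
  qed
  finally show ?thesis
    using assms by (simp add: ennreal_mult_le_mult_iff)
qed

text \<open>
  The cone over the sphere's part of the neighbourhood stays in the neighbourhood, because shrinking
  a vector of norm at most 1 shrinks the differences of its blocks.
\<close>

lemma emeasure_sphere_near_diagonal_le:
  assumes "i\<^sub>0 \<in> S" "0 < \<delta>" "\<delta> \<le> 2"
  shows "emeasure sphere_measure (sphere 0 1 \<inter> near_diagonal S i\<^sub>0 \<delta> :: (real ^ 'n ^ 'm) set)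
    \<le> of_nat DIM(real ^ 'n ^ 'm) *
      ennreal (3 ^ CARD('n) * 4 ^ (CARD('m) * CARD('n)) * \<delta> ^ ((card S - 1) * CARD('n)))"
proof -
  let ?E = "sphere 0 1 \<inter> near_diagonal S i\<^sub>0 \<delta> :: (real ^ 'n ^ 'm) set"
  let ?W = "cbox (\<chi> i c. -1) (\<chi> i c. 1) \<inter> near_diagonal S i\<^sub>0 \<delta> :: (real ^ 'n ^ 'm) set"
  have "{x. x \<noteq> 0 \<and> norm x \<le> 1 \<and> x /\<^sub>R norm x \<in> ?E} \<subseteq> ?W"
  proof
    fix x assume "x \<in> {x. x \<noteq> 0 \<and> norm x \<le> 1 \<and> x /\<^sub>R norm x \<in> ?E}"
    then have x: "norm x > 0" "norm x \<le> 1" "x /\<^sub>R norm x \<in> near_diagonal S i\<^sub>0 \<delta>" by auto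
    have "\<bar>x $ i $ c\<bar> \<le> 1" for i c
      using component_le_norm_cart[of "x $ i" c] Finite_Cartesian_Product.norm_nth_le[of x i] x by linarith
    moreover have "\<bar>x $ i $ c - x $ i\<^sub>0 $ c\<bar> \<le> \<delta>" if "i \<in> S" for i c
    proof -
      have "\<bar>x $ i $ c / norm x - x $ i\<^sub>0 $ c / norm x\<bar> \<le> \<delta>"
        using x that by (auto simp: near_diagonal_def field_simps)
      then have "\<bar>x $ i $ c - x $ i\<^sub>0 $ c\<bar> \<le> \<delta> * norm x"
        using x(1) by (simp add: field_simps flip: diff_divide_distrib)
      also have "\<dots> \<le> \<delta> * 1" using x assms by (intro mult_left_mono) auto
      finally show ?thesis by simp
    qed
    ultimately show "x \<in> ?W"
      by (auto simp: mem_cbox_blocks near_diagonal_def abs_le_iff minus_le_iff)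
  qed
  then have "emeasure lborel {x. x \<noteq> 0 \<and> norm x \<le> 1 \<and> x /\<^sub>R norm x \<in> ?E} \<le> emeasure lborel ?W"
    by (intro emeasure_mono) (auto intro!: borel_closed closed_Int closed_near_diagonal)
  also note emeasure_near_diagonal_le[OF assms]
  finally show ?thesis
    by (subst emeasure_sphere_measure) (auto intro!: mult_left_mono borel_closed closed_Int closed_near_diagonal)
qed

section \<open>Lower bounds for nonnegative integrands\<close>

lemma T_integrand_nonneg:
  assumes "0 \<le> rough_kernel \<Omega> (\<chi> i. x - y $ i) \<or> (\<exists>i. f i (y $ i) = 0)" "\<And>i y. 0 \<le> f i y"
  shows "0 \<le> T_integrand \<Omega> f x y"
proof (cases "\<exists>i. f i (y $ i) = 0")
  case True
  then have "(\<Prod>i\<in>UNIV. f i (y $ i)) = 0" by (auto intro: prod_zero)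
  then show ?thesis by (simp only: T_integrand_def mult_zero_right order_refl)
next
  case False
  with assms(1) have "0 \<le> rough_kernel \<Omega> (\<chi> i. x - y $ i)" by blast
  then show ?thesis using assms(2) unfolding T_integrand_def by (intro mult_nonneg_nonneg prod_nonneg) auto
qed

text \<open>
  For a nonnegative integrand both alternatives in the definition of the truncated integral give
  the same element of \<open>[0, \<infinity>]\<close>, so one lower bound serves both.
\<close>

lemma has_truncated_T_ge:
  assumes T: "has_truncated_T \<Omega> f x \<epsilon> v"
    and nonneg: "\<And>y. 0 \<le> T_integrand \<Omega> f x y"
    and Q: "Q \<in> sets lborel" "\<And>y. y \<in> Q \<Longrightarrow> \<epsilon> < norm (\<chi> i. x - y $ i)"
    and ge: "\<And>y. y \<in> Q \<Longrightarrow> c \<le> T_integrand \<Omega> f x y"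
  shows "enn2ereal (ennreal c * emeasure lborel Q) \<le> v"
proof -
  let ?D = "{y. norm (\<chi> i. x - y $ i) > \<epsilon>}"
  let ?I = "set_nn_integral lborel ?D (\<lambda>y. ennreal (T_integrand \<Omega> f x y))"
  have "ennreal c * emeasure lborel Q = (\<integral>\<^sup>+y. ennreal c * indicator Q y \<partial>lborel)"
    using Q by (simp add: nn_integral_cmult_indicator)
  also have "\<dots> \<le> ?I"
    using Q ge by (intro nn_integral_mono) (auto simp: indicator_def intro!: ennreal_leI)
  finally have "enn2ereal (ennreal c * emeasure lborel Q) \<le> enn2ereal ?I"
    by (simp add: less_eq_ennreal.rep_eq)
  moreover have "v = enn2ereal ?I"
  proof -
    have "enn2ereal ?I = ereal (set_lebesgue_integral lborel ?D (T_integrand \<Omega> f x))"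
      if "set_integrable lborel ?D (T_integrand \<Omega> f x)"
    proof -
      have "?I = (\<integral>\<^sup>+y. ennreal (indicator ?D y *\<^sub>R T_integrand \<Omega> f x y) \<partial>lborel)"
        by (intro nn_integral_cong) (auto simp: indicator_def)
      also have "\<dots> = ennreal (set_lebesgue_integral lborel ?D (T_integrand \<Omega> f x))"
        unfolding set_lebesgue_integral_def
        using that nonneg by (intro nn_integral_eq_integral) (auto simp: set_integrable_def)
      finally have "?I = ennreal (set_lebesgue_integral lborel ?D (T_integrand \<Omega> f x))" .
      moreover have "0 \<le> set_lebesgue_integral lborel ?D (T_integrand \<Omega> f x)"
        unfolding set_lebesgue_integral_def using nonneg by (intro integral_nonneg_AE) auto
      ultimately show ?thesis by simp
    qed
    then show ?thesis using T by (auto simp: has_truncated_T_def Let_def)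
  qed
  ultimately show ?thesis by simp
qed

text \<open>
  A set at positive distance from the singularity belongs to every sufficiently late truncation, so
  its contribution survives in the principal value.
\<close>

lemma has_T_value_ge:
  assumes T: "has_T_value \<Omega> f x v"
    and nonneg: "\<And>y. 0 \<le> T_integrand \<Omega> f x y"
    and Q: "Q \<in> sets lborel" "0 < r" "\<And>y. y \<in> Q \<Longrightarrow> r \<le> norm (\<chi> i. x - y $ i)"
    and ge: "\<And>y. y \<in> Q \<Longrightarrow> c \<le> T_integrand \<Omega> f x y"
  shows "enn2ereal (ennreal c * emeasure lborel Q) \<le> v"
proof -
  obtain I where I: "\<And>\<epsilon>. \<epsilon> > 0 \<Longrightarrow> has_truncated_T \<Omega> f x \<epsilon> (I \<epsilon>)" "(I \<longlongrightarrow> v) (at_right 0)"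
    using T by (auto simp: has_T_value_def)
  have "enn2ereal (ennreal c * emeasure lborel Q) \<le> I \<epsilon>" if "0 < \<epsilon>" "\<epsilon> < r" for \<epsilon>
    using that Q(3) by (intro has_truncated_T_ge[OF I(1) nonneg Q(1) _ ge]) force+
  then have "\<forall>\<^sub>F \<epsilon> in at_right 0. enn2ereal (ennreal c * emeasure lborel Q) \<le> I \<epsilon>"
    using \<open>0 < r\<close> by (auto simp: eventually_at_right_field)
  with I(2) show ?thesis
    by (intro tendsto_lowerbound) auto
qed

text \<open>
  Divergence of \<open>\<Sum>\<^sub>j c\<^sub>j\<^sup>p |A\<^sub>j|\<close> is the obstruction to \<open>g \<in> L\<^sup>p\<close> used in the end. Only powers of \<open>|g|\<close>
  are integrated, so exponents \<open>p < 1\<close> are allowed; the main argument needs them.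
\<close>

lemma summable_of_in_Lp:
  assumes g: "in_Lp M p g" and "0 < p"
    and A [measurable]: "\<And>j. A j \<in> sets M" and disj: "disjoint_family A"
    and v: "\<And>j. emeasure M (A j) = ennreal (v j)" "\<And>j. 0 \<le> v j"
    and c: "\<And>j. 0 \<le> c j" "AE x in M. \<forall>j. x \<in> A j \<longrightarrow> c j \<le> g x"
  shows "summable (\<lambda>j. c j powr p * v j)"
proof (rule summable_suminf_not_top)
  have "(\<Sum>j. ennreal (c j powr p * v j)) = (\<Sum>j. \<integral>\<^sup>+x. ennreal (c j powr p) * indicator (A j) x \<partial>M)"
    using v by (simp add: nn_integral_cmult_indicator ennreal_mult')
  also have "\<dots> = (\<integral>\<^sup>+x. (\<Sum>j. ennreal (c j powr p) * indicator (A j) x) \<partial>M)"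
    by (intro nn_integral_suminf[symmetric]) measurable
  also have "\<dots> \<le> (\<integral>\<^sup>+x. ennreal (\<bar>g x\<bar> powr p) \<partial>M)"
  proof (rule nn_integral_mono_AE, use c(2) in eventually_elim)
    case (elim x)
    show ?case
    proof (cases "\<exists>j. x \<in> A j")
      case True
      then obtain j where j: "x \<in> A j" ..
      with elim have "c j \<le> \<bar>g x\<bar>" by force
      moreover have "(\<Sum>j. ennreal (c j powr p) * indicator (A j) x) = ennreal (c j powr p)"
        using disj j by (intro suminf_cmult_indicator) auto
      ultimately show ?thesis
        using c(1)[of j] \<open>0 < p\<close> by (auto intro!: ennreal_leI powr_mono2)
    qed simp
  qed
  also have "\<dots> < \<infinity>"
    using g unfolding in_Lp_def by (auto simp: integrable_iff_bounded)
  finally show "(\<Sum>j. ennreal (c j powr p * v j)) \<noteq> top" by simp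
qed (use v in auto)

section \<open>Functions with prescribed decay and an odd function near the diagonal\<close>

definition weight :: "real \<Rightarrow> nat \<Rightarrow> real" where
  "weight s j = real (Suc j) powr (- s)"

lemma weight_pos: "0 < weight s j"
  by (simp add: weight_def)

lemma summable_weight: "1 < s \<Longrightarrow> summable (weight s)"
  unfolding weight_def
  using summable_Suc_iff[of "\<lambda>j. real j powr (- s)"] by (simp add: summable_real_powr_iff)

lemma suminf_ennreal_less_top:
  assumes "summable b" "\<And>j. 0 \<le> b j" "\<And>j. f j \<le> ennreal (b j)"
  shows "(\<Sum>j. f j) < \<infinity>"
proof -
  have "(\<Sum>j. f j) \<le> (\<Sum>j. ennreal (b j))"
    using assms(3) by (intro suminf_le) auto
  also have "\<dots> = ennreal (\<Sum>j. b j)"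
    using assms by (intro suminf_ennreal2) auto
  finally show ?thesis by (simp add: le_less_trans)
qed

text \<open>
  At \<open>|y| \<approx> 2\<^sup>j\<close> this is essentially \<open>(w\<^sub>j |y|\<^sup>-\<^sup>n)\<close> to the power \<open>1/r\<close>, the slowest power decay
  that borders on \<open>L\<^sup>r(\<real>\<^sup>n)\<close>, with a logarithmic correction supplied by the weight \<open>w\<^sub>j\<close>.
\<close>

definition tail_function :: "real \<Rightarrow> real \<Rightarrow> real ^ 'n \<Rightarrow> real" where
  "tail_function s r = root_series r (\<lambda>j. weight s j / (2 ^ j) ^ CARD('n))
     (\<lambda>j. cbox (\<chi> c. - (2 ^ j)) (\<chi> c. 2 ^ j))"

lemma in_Lp_tail_function:
  assumes "1 < s" "0 < r"
  shows "in_Lp lborel r (tail_function s r :: real ^ 'n \<Rightarrow> real)"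
  unfolding tail_function_def
proof (rule in_Lp_root_series)
  show "(\<Sum>j. ennreal (weight s j / (2 ^ j) ^ CARD('n))
      * emeasure lborel (cbox (\<chi> c. - (2 ^ j)) (\<chi> c. 2 ^ j) :: (real ^ 'n) set)) < \<infinity>"
  proof (rule suminf_ennreal_less_top)
    show "summable (\<lambda>j. 2 ^ CARD('n) * weight s j)"
      using assms by (intro summable_mult summable_weight)
    fix j
    show "0 \<le> 2 ^ CARD('n) * weight s j" using weight_pos[of s j] by simp
    have e: "emeasure lborel (cbox (\<chi> c. - (2 ^ j)) (\<chi> c. 2 ^ j) :: (real ^ 'n) set)
        = ennreal ((2 * 2 ^ j) ^ CARD('n))"
      by (subst emeasure_cbox_vec) auto
    show "ennreal (weight s j / (2 ^ j) ^ CARD('n))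
      * emeasure lborel (cbox (\<chi> c. - (2 ^ j)) (\<chi> c. 2 ^ j) :: (real ^ 'n) set)
      \<le> ennreal (2 ^ CARD('n) * weight s j)"
      unfolding e using weight_pos[of s j]
      by (subst ennreal_mult'[symmetric]) (auto simp: power_mult_distrib)
  qed
qed (use assms in auto)

lemma tail_function_ge:
  fixes y :: "real ^ 'n"
  assumes "1 < s" "0 < r" "y \<in> cbox (\<chi> c. - (2 ^ j)) (\<chi> c. 2 ^ j)"
  shows "(weight s j / (2 ^ j) ^ CARD('n)) powr (1 / r) \<le> tail_function s r y"
  unfolding tail_function_def
proof (rule root_series_ge[of _ "\<lambda>j. cbox (\<chi> c. - (2 ^ j)) (\<chi> c. 2 ^ j)"])
  show "(\<Sum>j. ennreal (weight s j / (2 ^ j) ^ CARD('n))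
      * indicator (cbox (\<chi> c. - (2 ^ j)) (\<chi> c. 2 ^ j)) y) < \<infinity>"
  proof (rule suminf_ennreal_less_top)
    show "summable (weight s)" using assms by (intro summable_weight)
    fix j
    show "0 \<le> weight s j" using weight_pos[of s j] by simp
    have "weight s j / (2 ^ j) ^ CARD('n) \<le> weight s j / 1"
      using weight_pos[of s j] by (intro divide_left_mono) (auto intro!: one_le_power)
    then show "ennreal (weight s j / (2 ^ j) ^ CARD('n))
      * indicator (cbox (\<chi> c. - (2 ^ j)) (\<chi> c. 2 ^ j)) y \<le> ennreal (weight s j)"
      by (auto simp: indicator_def intro!: ennreal_leI)
  qed
qed (use assms weight_pos[of s j] in auto)

lemma tail_function_nonneg: "0 \<le> tail_function s r y"
  by (simp add: tail_function_def root_series_nonneg)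

text \<open>
  The singularity along the diagonal is the strongest power that the codimension \<open>(k-1)n\<close>,
  \<open>k = |S|\<close>, allows in \<open>L\<^sup>q\<close>, weakened logarithmically by the weights. The sign factor makes the
  function odd, and the coordinate \<open>(i\<^sub>0, c\<^sub>0)\<close> is positive for the directions used later.
\<close>

definition odd_rough :: "real \<Rightarrow> real \<Rightarrow> 'm set \<Rightarrow> 'm \<Rightarrow> 'n \<Rightarrow> real ^ 'n ^ 'm \<Rightarrow> real" where
  "odd_rough s q S i\<^sub>0 c\<^sub>0 \<theta> = sgn (\<theta> $ i\<^sub>0 $ c\<^sub>0) *
     root_series q (\<lambda>j. weight s j * (2 ^ j) ^ ((card S - 1) * CARD('n)))
       (\<lambda>j. sphere 0 1 \<inter> near_diagonal S i\<^sub>0 (2 / 2 ^ j)) \<theta>"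

lemma odd_on_sphere_odd_rough:
  fixes S :: "'m::finite set" and c\<^sub>0 :: "'n::finite"
  shows "odd_on_sphere (odd_rough s q S i\<^sub>0 c\<^sub>0)"
proof -
  have "- \<theta> \<in> near_diagonal S i\<^sub>0 \<delta> \<longleftrightarrow> \<theta> \<in> near_diagonal S i\<^sub>0 \<delta>"
    for \<delta> and \<theta> :: "real ^ 'n ^ 'm"
    by (simp add: near_diagonal_def abs_minus_commute)
  then have "- \<theta> \<in> sphere 0 1 \<inter> near_diagonal S i\<^sub>0 \<delta> \<longleftrightarrow> \<theta> \<in> sphere 0 1 \<inter> near_diagonal S i\<^sub>0 \<delta>"
    for \<delta> and \<theta> :: "real ^ 'n ^ 'm" by simp
  then show ?thesis
    by (simp only: odd_on_sphere_def odd_rough_def root_series_def indicator_def) (simp add: sgn_minus)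
qed

lemma in_Lp_odd_rough:
  fixes S :: "'m::finite set" and c\<^sub>0 :: "'n::finite"
  assumes "1 < s" "0 < q" "i\<^sub>0 \<in> S"
  shows "in_Lp sphere_measure q (odd_rough s q S i\<^sub>0 c\<^sub>0 :: real ^ 'n ^ 'm \<Rightarrow> real)"
proof -
  let ?N = "(card S - 1) * CARD('n)"
  let ?a = "\<lambda>j. weight s j * (2 ^ j) ^ ?N"
  let ?A = "\<lambda>j. sphere 0 1 \<inter> near_diagonal S i\<^sub>0 (2 / 2 ^ j) :: (real ^ 'n ^ 'm) set"
  have A: "?A j \<in> sets sphere_measure" for j
    unfolding sets_sphere_measure sets_restrict_space
    by (auto intro!: borel_closed closed_near_diagonal)
  let ?C = "real DIM(real ^ 'n ^ 'm) * (3 ^ CARD('n) * 4 ^ (CARD('m) * CARD('n)) * 2 ^ ?N)"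
  have "in_Lp sphere_measure q (root_series q ?a ?A)"
  proof (rule in_Lp_root_series[OF A \<open>0 < q\<close>], rule suminf_ennreal_less_top)
    show "summable (\<lambda>j. ?C * weight s j)"
      using assms by (intro summable_mult summable_weight)
    fix j
    show "0 \<le> ?C * weight s j" using weight_pos[of s j] by simp
    have "ennreal (?a j) * emeasure sphere_measure (?A j) \<le> ennreal (?a j) *
       (of_nat DIM(real ^ 'n ^ 'm) * ennreal (3 ^ CARD('n) * 4 ^ (CARD('m) * CARD('n)) * (2 / 2 ^ j) ^ ?N))"
      using assms by (intro mult_left_mono emeasure_sphere_near_diagonal_le) (auto simp: field_simps)
    also have "\<dots> = ennreal (?a j * (real DIM(real ^ 'n ^ 'm) *
        (3 ^ CARD('n) * 4 ^ (CARD('m) * CARD('n)) * (2 / 2 ^ j) ^ ?N)))"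
      using weight_pos[of s j]
      by (simp only: ennreal_of_nat_eq_real_of_nat) (simp add: ennreal_mult)
    also have "?a j * (real DIM(real ^ 'n ^ 'm) *
        (3 ^ CARD('n) * 4 ^ (CARD('m) * CARD('n)) * (2 / 2 ^ j) ^ ?N)) = ?C * weight s j"
      by (simp add: power_divide)
    finally show "ennreal (?a j) * emeasure sphere_measure (?A j) \<le> ennreal (?C * weight s j)" .
  qed
  moreover have "odd_rough s q S i\<^sub>0 c\<^sub>0 \<in> borel_measurable (sphere_measure :: (real ^ 'n ^ 'm) measure)"
  proof -
    have "(\<lambda>\<theta> :: real ^ 'n ^ 'm. \<theta> $ i\<^sub>0 $ c\<^sub>0) \<in> borel_measurable borel"
      by (intro borel_measurable_continuous_onI continuous_intros)
    then have "(\<lambda>\<theta> :: real ^ 'n ^ 'm. sgn (\<theta> $ i\<^sub>0 $ c\<^sub>0)) \<in> borel_measurable (restrict_space borel (sphere 0 1))"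
      by (intro measurable_restrict_space1) measurable
    then have "(\<lambda>\<theta> :: real ^ 'n ^ 'm. sgn (\<theta> $ i\<^sub>0 $ c\<^sub>0)) \<in> borel_measurable sphere_measure"
      by (simp add: measurable_cong_sets[OF sets_sphere_measure refl])
    then show ?thesis
      unfolding odd_rough_def by (intro borel_measurable_times root_series_measurable A)
  qed
  ultimately show ?thesis
    by (rule in_Lp_dominated)
       (use assms in \<open>auto simp: odd_rough_def abs_mult abs_sgn_eq root_series_nonneg\<close>)
qed

lemma odd_rough_nonneg: "0 \<le> \<theta> $ i\<^sub>0 $ c\<^sub>0 \<Longrightarrow> 0 \<le> odd_rough s q S i\<^sub>0 c\<^sub>0 \<theta>"
  by (auto simp: odd_rough_def root_series_nonneg sgn_if)

text \<open>
  On the diagonal itself the series diverges. A point with two distinct blocks in \<open>S\<close> leaves the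
  neighbourhoods at a finite scale, so there the series is a finite sum and any of its terms is a
  lower bound.
\<close>

lemma odd_rough_ge:
  fixes \<theta> :: "real ^ 'n ^ 'm"
  assumes "0 < q" and \<theta>: "norm \<theta> = 1" "\<theta> \<in> near_diagonal S i\<^sub>0 (2 / 2 ^ j)" "0 < \<theta> $ i\<^sub>0 $ c\<^sub>0"
    and off: "i \<in> S" "\<theta> $ i $ c\<^sub>0 \<noteq> \<theta> $ i\<^sub>0 $ c\<^sub>0"
  shows "(weight s j * (2 ^ j) ^ ((card S - 1) * CARD('n))) powr (1 / q) \<le> odd_rough s q S i\<^sub>0 c\<^sub>0 \<theta>"
proof -
  let ?a = "\<lambda>j. weight s j * (2 ^ j) ^ ((card S - 1) * CARD('n))"
  let ?A = "\<lambda>j. sphere 0 1 \<inter> near_diagonal S i\<^sub>0 (2 / 2 ^ j) :: (real ^ 'n ^ 'm) set"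
  let ?d = "\<bar>\<theta> $ i $ c\<^sub>0 - \<theta> $ i\<^sub>0 $ c\<^sub>0\<bar>"
  obtain N where N: "2 / ?d < 2 ^ N"
    using real_arch_pow[of 2] by auto
  have out: "\<theta> \<notin> ?A l" if "N \<le> l" for l
  proof
    assume "\<theta> \<in> ?A l"
    then have "?d \<le> 2 / 2 ^ l" using off(1) by (auto simp: near_diagonal_def)
    moreover have "(2::real) ^ N \<le> 2 ^ l" using that by simp
    ultimately have "?d \<le> 2 / 2 ^ N"
      by (meson divide_left_mono mult_pos_pos order_trans zero_le_numeral zero_less_numeral zero_less_power)
    then show False using N off(2) by (simp add: field_simps)
  qed
  have "(\<Sum>l. ennreal (?a l) * indicator (?A l) \<theta>) = (\<Sum>l<N. ennreal (?a l) * indicator (?A l) \<theta>)"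
    by (rule suminf_finite) (use out in \<open>auto simp: indicator_def\<close>)
  also have "\<dots> < \<infinity>"
    by (auto simp: indicator_def ennreal_mult_less_top)
  finally have "?a j powr (1 / q) \<le> root_series q ?a ?A \<theta>"
    using assms weight_pos[of s j] by (intro root_series_ge) auto
  then show ?thesis using \<theta>(3) by (simp add: odd_rough_def)
qed

section \<open>The operator at scale \<open>2\<^sup>j\<close>\<close>

lemma powr_collect:
  fixes w R L h q B :: real
  assumes "0 < w" "0 < R" "0 < L"
  shows "(w * R ^ a) powr (1 / q) / (L * R) ^ b * (w / R ^ n) powr B * (h * R ^ d)
    = h / L ^ b * w powr (1 / q + B) * R powr (a / q - b - n * B + d)"
proof -
  have q: "(w * R ^ a) powr (1 / q) = w powr (1 / q) * R powr (a / q)"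
    using assms by (simp add: powr_mult powr_powr flip: powr_realpow)
  have B: "(w / R ^ n) powr B = w powr B / R powr (n * B)"
    using assms by (simp add: powr_divide powr_powr flip: powr_realpow)
  have R: "R powr (a / q - b - n * B + d) = R powr (a / q) / R ^ b / R powr (n * B) * R ^ d"
    using assms by (simp add: powr_add powr_diff powr_realpow)
  show ?thesis
    unfolding q B R powr_add[of w] by (simp add: power_mult_distrib ac_simps)
qed

lemma norm_blocks_le:
  fixes z :: "real ^ 'n ^ 'm"
  assumes "\<And>i c. \<bar>z $ i $ c\<bar> \<le> b"
  shows "norm z \<le> real (CARD('m) * CARD('n)) * b"
proof -
  have "norm z \<le> (\<Sum>i\<in>UNIV. norm (z $ i))"
    by (simp add: norm_vec_def L2_set_le_sum)
  also have "\<dots> \<le> (\<Sum>i\<in>(UNIV :: 'm set). \<Sum>c\<in>(UNIV :: 'n set). b)"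
    by (intro sum_mono order_trans[OF norm_le_l1_cart] assms)
  finally show ?thesis by simp
qed

text \<open>
  The integral is bounded below by the part over a box \<open>Q\<close> of points \<open>y\<close> on which every factor is
  bounded below. The blocks in \<open>S\<close> range over boxes of size about 1, which puts the direction of
  \<open>(x - y\<^sub>1, \<dots>, x - y\<^sub>m)\<close> at distance at most \<open>2/R\<close> from the diagonal, \<open>R = 2\<^sup>j\<close>. The other blocks range over the
  cube \<open>[-R,R]\<^sup>n\<close>, so that the volume of \<open>Q\<close> supplies \<open>R\<close> to the power \<open>n|-S|\<close>. The norm of
  \<open>(x - y\<^sub>1, \<dots>, x - y\<^sub>m)\<close> is comparable to \<open>R\<close> on \<open>Q\<close>.
\<close>

lemma T_value_ge:
  fixes S :: "'m::finite set" and c\<^sub>0 :: "'n::finite" and P :: "real ^ 'm" and x :: "real ^ 'n"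
  assumes s: "1 < s" and q: "0 < q" and P: "\<And>i. 0 < P $ i"
    and S: "i\<^sub>0 \<in> S" "i\<^sub>1 \<in> S" "i\<^sub>1 \<noteq> i\<^sub>0"
    and x: "x \<in> cbox (\<chi> c. 2 * 2 ^ j) (\<chi> c. 3 * 2 ^ j)"
    and T: "has_T_value (odd_rough s q S i\<^sub>0 c\<^sub>0)
      (\<lambda>i. if i \<in> S then indicator (cbox (\<chi> c. -1) (\<chi> c. 1)) else tail_function s (P $ i)) x (ereal v)"
  defines "n \<equiv> CARD('n)" and "N \<equiv> CARD('m) * CARD('n)"
    and "B \<equiv> \<Sum>i\<in>-S. 1 / P $ i"
  shows "(1 / 2) ^ N / (4 * real N) ^ N * weight s j powr (1 / q + B)
    * (2 ^ j) powr (((card S - 1) * n) / q - N - n * B + n * card (- S)) \<le> v"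
proof -
  let ?f = "\<lambda>i. if i \<in> S then indicator (cbox (\<chi> c. -1) (\<chi> c. 1))
    else tail_function s (P $ i) :: real ^ 'n \<Rightarrow> real"
  let ?\<Omega> = "odd_rough s q S i\<^sub>0 c\<^sub>0 :: real ^ 'n ^ 'm \<Rightarrow> real"
  let ?w = "weight s j"
  define R :: real where "R = 2 ^ j"
  have R: "1 \<le> R" by (simp add: R_def)
  have w: "0 < ?w" by (rule weight_pos)
  have N: "0 < N" by (simp add: N_def)
  have x: "2 * R \<le> x $ c" "x $ c \<le> 3 * R" for c
    using x by (auto simp: mem_box_cart R_def)
  \<comment> \<open>Block \<open>i\<^sub>0\<close> is kept apart from the other blocks in \<open>S\<close>: the direction then avoids the diagonal,
    where \<open>\<Omega>\<close> takes a default value.\<close>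
  define l where "l = (\<lambda>i. if i \<in> S then (if i = i\<^sub>0 then 1 / 2 else -1) else - R)"
  define u where "u = (\<lambda>i. if i \<in> S then (if i = i\<^sub>0 then 1 else 0) else R)"
  define Q :: "(real ^ 'n ^ 'm) set" where "Q = cbox (\<chi> i c. l i) (\<chi> i c. u i)"
  have Q: "l i \<le> y $ i $ c" "y $ i $ c \<le> u i" if "y \<in> Q" for y i c
    using that by (auto simp: Q_def mem_cbox_blocks)
  define a where "a = (?w * R ^ ((card S - 1) * n)) powr (1 / q) / ((4 * real N) * R) ^ N * (?w / R ^ n) powr B"
  define h where "h = (1 / 2) ^ N * R ^ (n * card (- S))"
  have a: "0 \<le> a" using R w by (simp add: a_def)

  have vol: "ennreal h \<le> emeasure lborel Q"
  proof -
    have "h = (\<Prod>i\<in>(UNIV :: 'm set). (1 / 2) ^ n * (if i \<in> - S then R ^ n else 1))"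
      by (simp add: h_def prod.distrib N_def n_def power_mult[symmetric] mult.commute flip: prod.inter_filter Compl_eq)
    also have "\<dots> \<le> (\<Prod>i\<in>(UNIV :: 'm set). \<Prod>c\<in>(UNIV :: 'n set). u i - l i)"
    proof (intro prod_mono conjI)
      fix i :: 'm
      show "0 \<le> (1 / 2) ^ n * (if i \<in> - S then R ^ n else 1)" using R by simp
      have "(1 / 2) ^ n * (if i \<in> - S then R ^ n else 1) = ((1 / 2) * (if i \<in> - S then R else 1)) ^ n"
        by (auto simp: power_mult_distrib power_divide)
      also have "\<dots> \<le> (u i - l i) ^ n"
        using R by (intro power_mono) (auto simp: u_def l_def)
      finally show "(1 / 2) ^ n * (if i \<in> - S then R ^ n else 1) \<le> (\<Prod>c\<in>(UNIV :: 'n set). u i - l i)"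
        by (simp add: n_def)
    qed
    finally have "ennreal h \<le> ennreal (\<Prod>i\<in>(UNIV :: 'm set). \<Prod>c\<in>(UNIV :: 'n set). u i - l i)"
      by (rule ennreal_leI)
    also have "\<dots> = emeasure lborel Q"
      using R unfolding Q_def by (subst emeasure_cbox_blocks) (auto simp: u_def l_def)
    finally show ?thesis .
  qed

  have z: "0 \<le> (\<chi> i. x - y $ i) $ i $ c" "(\<chi> i. x - y $ i) $ i $ c \<le> 4 * R" "R \<le> (\<chi> i. x - y $ i) $ i\<^sub>0 $ c"
    if "y \<in> Q" for y i c
    using x[of c] Q[OF that, of i c] Q[OF that, of i\<^sub>0 c] R S(1)
    by (auto simp: l_def u_def split: if_splits)
  have norm_ge: "R \<le> norm (\<chi> i. x - y $ i)" if "y \<in> Q" for y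
    using z(3)[OF that, of c\<^sub>0] component_le_norm_cart[of "(\<chi> i. x - y $ i) $ i\<^sub>0" c\<^sub>0]
      Finite_Cartesian_Product.norm_nth_le[of "\<chi> i. x - y $ i" i\<^sub>0] by linarith
  have norm_le: "norm (\<chi> i. x - y $ i) \<le> (4 * real N) * R" if "y \<in> Q" for y
    using norm_blocks_le[of "\<chi> i. x - y $ i" "4 * R"] z(1,2)[OF that]
    by (auto simp: N_def ac_simps)

  have kernel_ge: "(?w * R ^ ((card S - 1) * n)) powr (1 / q) / ((4 * real N) * R) ^ N
      \<le> rough_kernel ?\<Omega> (\<chi> i. x - y $ i)" if y: "y \<in> Q" for y
  proof -
    let ?z = "\<chi> i. x - y $ i"
    let ?\<theta> = "?z /\<^sub>R norm ?z"
    have pos: "0 < norm ?z" using norm_ge[OF y] R by linarith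
    have "(?w * R ^ ((card S - 1) * n)) powr (1 / q) \<le> ?\<Omega> ?\<theta>"
      unfolding R_def n_def
    proof (rule odd_rough_ge[OF q])
      show "norm ?\<theta> = 1" using pos by simp
      show "?\<theta> \<in> near_diagonal S i\<^sub>0 (2 / 2 ^ j)"
        unfolding near_diagonal_def
      proof (intro CollectI ballI allI)
        fix i c assume i: "i \<in> S"
        have "\<bar>?z $ i $ c - ?z $ i\<^sub>0 $ c\<bar> \<le> 2"
          using Q[OF y, of i c] Q[OF y, of i\<^sub>0 c] i S(1) by (auto simp: l_def u_def split: if_splits)
        also have "\<dots> \<le> 2 / R * norm ?z"
          using norm_ge[OF y] R by (simp add: field_simps)
        finally have "\<bar>?z $ i $ c - ?z $ i\<^sub>0 $ c\<bar> / norm ?z \<le> 2 / R"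
          using pos by (simp only: pos_divide_le_eq)
        moreover have "?\<theta> $ i $ c - ?\<theta> $ i\<^sub>0 $ c = (?z $ i $ c - ?z $ i\<^sub>0 $ c) / norm ?z"
          by (simp only: vector_scaleR_component real_scaleR_def divide_inverse right_diff_distrib mult.commute)
        ultimately show "\<bar>?\<theta> $ i $ c - ?\<theta> $ i\<^sub>0 $ c\<bar> \<le> 2 / 2 ^ j"
          by (simp only: abs_divide abs_norm_cancel R_def)
      qed
      show "0 < ?\<theta> $ i\<^sub>0 $ c\<^sub>0"
        using z(3)[OF y, of c\<^sub>0] R pos by simp
      show "i\<^sub>1 \<in> S" by fact
      have "y $ i\<^sub>1 $ c\<^sub>0 \<noteq> y $ i\<^sub>0 $ c\<^sub>0"
        using Q(2)[OF y, of i\<^sub>1 c\<^sub>0] Q(1)[OF y, of i\<^sub>0 c\<^sub>0] S by (auto simp: l_def u_def)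
      then show "?\<theta> $ i\<^sub>1 $ c\<^sub>0 \<noteq> ?\<theta> $ i\<^sub>0 $ c\<^sub>0" using pos by simp
    qed
    moreover from this have "0 \<le> ?\<Omega> ?\<theta>" by (rule order_trans[OF powr_ge_zero])
    moreover have "norm ?z ^ N \<le> ((4 * real N) * R) ^ N"
      using norm_le[OF y] by (intro power_mono) auto
    ultimately show ?thesis
      unfolding rough_kernel_def N_def[symmetric] using pos by (intro frac_le) auto
  qed

  have tails_ge: "(?w / R ^ n) powr B \<le> (\<Prod>i\<in>UNIV. ?f i (y $ i))" if y: "y \<in> Q" for y
  proof -
    have "(?w / R ^ n) powr B = (\<Prod>i\<in>-S. (?w / R ^ n) powr (1 / P $ i))"
      unfolding B_def using w R by (intro powr_sum) auto
    also have "\<dots> = (\<Prod>i\<in>UNIV. if i \<in> -S then (?w / R ^ n) powr (1 / P $ i) else 1)"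
      by (simp flip: prod.inter_filter Compl_eq)
    also have "\<dots> \<le> (\<Prod>i\<in>UNIV. ?f i (y $ i))"
    proof (intro prod_mono conjI)
      fix i
      show "0 \<le> (if i \<in> -S then (?w / R ^ n) powr (1 / P $ i) else 1)" by simp
      show "(if i \<in> -S then (?w / R ^ n) powr (1 / P $ i) else 1) \<le> ?f i (y $ i)"
      proof (cases "i \<in> S")
        case True
        have "-1 \<le> y $ i $ c \<and> y $ i $ c \<le> 1" for c
          using Q[OF y, of i c] True by (auto simp: l_def u_def split: if_splits)
        then show ?thesis using True by (simp add: mem_box_cart)
      next
        case False
        then have "y $ i \<in> cbox (\<chi> c. - (2 ^ j)) (\<chi> c. 2 ^ j)"
          using Q[OF y, of i] by (auto simp: mem_box_cart l_def u_def R_def)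
        from tail_function_ge[OF s P this] False show ?thesis
          by (simp add: R_def n_def)
      qed
    qed
    finally show ?thesis .
  qed

  have "enn2ereal (ennreal a * emeasure lborel Q) \<le> ereal v"
  proof (rule has_T_value_ge[OF T])
    show "0 \<le> T_integrand ?\<Omega> ?f x y" for y
    proof (rule T_integrand_nonneg)
      show "0 \<le> rough_kernel ?\<Omega> (\<chi> i. x - y $ i) \<or> (\<exists>i. ?f i (y $ i) = 0)"
      \<comment> \<open>Where the sign factor of \<open>\<Omega>\<close> could be negative, \<open>y\<^sub>i\<^sub>0\<close> is outside the support of \<open>f\<^sub>i\<^sub>0\<close>.\<close>
      proof (cases "y $ i\<^sub>0 $ c\<^sub>0 \<le> 1")
        case True
        then have "0 \<le> ((\<chi> i. x - y $ i) /\<^sub>R norm (\<chi> i. x - y $ i)) $ i\<^sub>0 $ c\<^sub>0"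
          using x[of c\<^sub>0] R by simp
        then show ?thesis by (auto simp: rough_kernel_def intro!: divide_nonneg_nonneg odd_rough_nonneg)
      next
        case False
        then have "y $ i\<^sub>0 \<notin> cbox (\<chi> c. -1) (\<chi> c. 1)" by (auto simp: mem_box_cart)
        then have "?f i\<^sub>0 (y $ i\<^sub>0) = 0" using S(1) by simp
        then show ?thesis by blast
      qed
    qed (simp add: tail_function_nonneg)
    show "Q \<in> sets lborel" by (simp add: Q_def)
    show "0 < R" using R by simp
    show "R \<le> norm (\<chi> i. x - y $ i)" if "y \<in> Q" for y using norm_ge that .
    show "a \<le> T_integrand ?\<Omega> ?f x y" if "y \<in> Q" for y
      unfolding a_def T_integrand_def using R
      by (intro mult_mono kernel_ge[OF that] tails_ge[OF that] order_trans[OF _ kernel_ge[OF that]]) auto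
  qed
  moreover have "enn2ereal (ennreal (a * h)) \<le> enn2ereal (ennreal a * emeasure lborel Q)"
    unfolding less_eq_ennreal.rep_eq[symmetric] ennreal_mult'[OF a] by (intro mult_left_mono vol) simp
  ultimately have "enn2ereal (ennreal (a * h)) \<le> ereal v" by (rule order_trans[rotated])
  moreover have "0 \<le> a * h" using a R by (simp add: h_def)
  ultimately have "a * h \<le> v" by (simp add: enn2ereal_ennreal)
  moreover have "a * h = (1 / 2) ^ N / (4 * real N) ^ N * ?w powr (1 / q + B)
    * R powr (((card S - 1) * n) / q - N - n * B + n * card (- S))"
    unfolding a_def h_def using w R N by (intro powr_collect) auto
  ultimately show ?thesis by (simp add: R_def)
qed

section \<open>Divergence of the dyadic sum\<close>

theorem proposition3:
  fixes q p :: real and P :: "real ^ 'm"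
  assumes "q > 1"
    and "\<forall>i. P $ i > 1"
    and "1 / p = (\<Sum>i\<in>UNIV. 1 / P $ i)"
    and "(\<chi> i. 1 / P $ i) \<notin> H_region q"
  shows "\<exists>(\<Omega> :: real ^ 'n ^ 'm \<Rightarrow> real) (f :: 'm \<Rightarrow> real ^ 'n \<Rightarrow> real).
           in_Lp sphere_measure q \<Omega> \<and> odd_on_sphere \<Omega> \<and>
           (\<forall>i. in_Lp lborel (P $ i) (f i)) \<and>
           \<not> T_in_Lp \<Omega> f p"
proof -
  have q: "1 < q" and P: "1 < P $ i" for i using assms by auto
  obtain \<alpha> :: "'m \<Rightarrow> nat" where \<alpha>: "\<And>i. \<alpha> i \<in> {0, 1}"
    and fail: "real (\<Sum>i\<in>UNIV. \<alpha> i) \<le> (\<Sum>i\<in>UNIV. real (\<alpha> i) / P $ i) + (real (\<Sum>i\<in>UNIV. \<alpha> i) - 1) / q"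
    using assms(4) by (auto simp: H_region_def not_less)
  define S where "S = {i. \<alpha> i = 1}"
  define k where "k = card S"
  have \<alpha>': "\<alpha> i = (if i \<in> S then 1 else 0)" for i using \<alpha>[of i] by (auto simp: S_def)
  define B where "B = (\<Sum>i\<in>-S. 1 / P $ i)"
  define A where "A = (\<Sum>i\<in>S. 1 / P $ i)"
  have "(\<Sum>i\<in>UNIV. \<alpha> i) = k"
    by (simp add: \<alpha>' k_def sum.If_cases)
  moreover have "(\<Sum>i\<in>UNIV. real (\<alpha> i) / P $ i) = A"
    unfolding A_def
    by (simp add: \<alpha>' if_distrib[of real] if_distrib[of "\<lambda>a. a / _"] flip: sum.inter_filter cong: if_cong)
  ultimately have kA: "real k \<le> A + (real k - 1) / q" using fail by simp
  have A_le: "A \<le> k"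
  proof -
    have "A \<le> (\<Sum>i\<in>S. 1)"
      unfolding A_def
      by (intro sum_mono) (use P in \<open>auto simp: divide_le_eq intro: less_imp_le less_trans[OF zero_less_one P]\<close>)
    then show ?thesis by (simp add: k_def)
  qed
  \<comment> \<open>Blocks can only be compared if there are two of them; \<open>k \<le> 1\<close> contradicts \<open>q > 1\<close> or \<open>p\<^sub>i > 1\<close>.\<close>
  have k: "2 \<le> k"
  proof (rule ccontr)
    assume "\<not> 2 \<le> k"
    then consider "k = 0" | "k = 1" by linarith
    then show False
    proof cases
      case 1
      have "1 / q \<le> A" using 1 kA by simp
      moreover have "A \<le> 0" using 1 A_le by simp
      moreover have "0 < 1 / q" using q by simp
      ultimately show ?thesis by linarith
    next
      case 2
      then obtain i where "S = {i}" unfolding k_def by (auto simp: card_1_singleton_iff)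
      then show ?thesis using kA 2 P[of i] by (simp add: A_def)
    qed
  qed
  obtain i\<^sub>0 i\<^sub>1 where S: "i\<^sub>0 \<in> S" "i\<^sub>1 \<in> S" "i\<^sub>1 \<noteq> i\<^sub>0"
    using k unfolding k_def by (metis card_le_Suc0_iff_eq finite not_less_eq_eq numeral_2_eq_2)
  have B: "0 \<le> B"
    unfolding B_def
    by (intro sum_nonneg) (use P in \<open>auto intro: less_imp_le less_trans[OF zero_less_one P]\<close>)
  have pAB: "1 / p = A + B"
    unfolding assms(3) A_def B_def by (subst sum.union_disjoint[symmetric]) auto
  have A: "1 / q < A"
  proof -
    have "(real k - 1) / q \<le> (real k - 1) / 1" using q k by (intro divide_left_mono) auto
    with kA have "1 \<le> A" by simp
    moreover have "1 / q < 1" using q by simp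
    ultimately show ?thesis by linarith
  qed
  have p: "0 < p"
  proof -
    have "0 < 1 / q" using q by simp
    then have "0 < 1 / p" using A B pAB by linarith
    then show ?thesis by simp
  qed
  \<comment> \<open>This exponent makes the contribution of scale \<open>j\<close> to the integral of \<open>|T|\<^sup>p\<close> at least a
    constant times \<open>1/(j+1)\<close>.\<close>
  define s where "s = 1 / (p * (1 / q + B))"
  have qB: "0 < 1 / q + B" using q B by (intro add_pos_nonneg) auto
  have s: "1 < s"
  proof -
    have "p * (1 / q + B) < p * (1 / p)" using A p unfolding pAB by (intro mult_strict_left_mono) auto
    then show ?thesis using p qB by (simp add: s_def)
  qed
  obtain c\<^sub>0 :: 'n where True by simp
  define \<Omega> where "\<Omega> = (odd_rough s q S i\<^sub>0 c\<^sub>0 :: real ^ 'n ^ 'm \<Rightarrow> real)"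
  define f where "f = (\<lambda>i. if i \<in> S then indicator (cbox (\<chi> c. -1) (\<chi> c. 1))
    else tail_function s (P $ i) :: real ^ 'n \<Rightarrow> real)"
  have "\<not> T_in_Lp \<Omega> f p"
  proof
    assume "T_in_Lp \<Omega> f p"
    then obtain g where g: "in_Lp lborel p g" "AE x in lborel. has_T_value \<Omega> f x (ereal (g x))"
      by (auto simp: T_in_Lp_def)
    define n where "n = CARD('n)"
    define N where "N = CARD('m) * CARD('n)"
    define K :: real where "K = (1 / 2) ^ N / (4 * real N) ^ N"
    define e where "e = ((k - 1) * n) / q - N - n * B + n * card (- S)"
    define c where "c = (\<lambda>j. K * weight s j powr (1 / q + B) * (2 ^ j) powr e)"
    let ?A = "\<lambda>j. cbox (\<chi> c. 2 * 2 ^ j) (\<chi> c. 3 * 2 ^ j) :: (real ^ 'n) set"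
    have K: "0 < K" by (simp add: K_def N_def)
    have summable: "summable (\<lambda>j. c j powr p * (2 ^ j) ^ n)"
    proof (rule summable_of_in_Lp[OF g(1) p])
      show "disjoint_family ?A"
      proof (unfold disjoint_family_on_def, intro ballI impI)
        have "?A i \<inter> ?A j = {}" if "i < j" for i j
        proof -
          have "(2::real) ^ Suc i \<le> 2 ^ j" using that by (intro power_increasing) auto
          then have "3 * 2 ^ i < 2 * (2 ^ j :: real)" using zero_less_power[of "2::real" i] by (simp del: zero_less_power)
          then show ?thesis by (auto simp: mem_box_cart) (meson not_le order_trans)
        qed
        then show "?A i \<inter> ?A j = {}" if "i \<noteq> j" for i j
          using that by (metis Int_commute linorder_neqE_nat)
      qed
      show "emeasure lborel (?A j) = ennreal ((2 ^ j) ^ n)" for j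
        by (subst emeasure_cbox_vec) (auto simp: n_def)
      show "AE x in lborel. \<forall>j. x \<in> ?A j \<longrightarrow> c j \<le> g x"
        using g(2)
      proof eventually_elim
        case (elim x)
        have "0 < P $ i" for i using P[of i] by simp
        then show ?case
          using T_value_ge[OF s _ _ S _ elim[unfolded \<Omega>_def f_def]] q
          by (simp add: c_def K_def e_def n_def N_def B_def k_def)
      qed
      show "0 \<le> c j" for j using K by (simp add: c_def)
    qed auto
    have lower: "K powr p * (1 / real (Suc j)) \<le> c j powr p * (2 ^ j) ^ n" for j
    proof -
      have "- s * (1 / q + B) * p = -1" using qB p by (simp add: s_def)
      then have "(weight s j powr (1 / q + B)) powr p = real (Suc j) powr -1"
        unfolding weight_def powr_powr by (simp only:)
      also have "\<dots> = 1 / real (Suc j)"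
        by (simp add: powr_minus_divide)
      finally have w: "(weight s j powr (1 / q + B)) powr p = 1 / real (Suc j)" .
      \<comment> \<open>The failing inequality enters here: the power of \<open>2\<^sup>j\<close> in the contribution of scale \<open>j\<close> is nonnegative.\<close>
      have "0 \<le> e * p + n"
      proof -
        have "card (- S) = CARD('m) - k" "k \<le> CARD('m)"
          by (simp_all add: k_def Compl_eq_Diff_UNIV card_Diff_subset card_mono)
        then have "e = n * ((real k - 1) / q - k - B)"
          using k unfolding e_def N_def n_def by (simp add: of_nat_diff algebra_simps)
        moreover have "n * ((real k - 1) / q - k - B) \<ge> n * (- (1 / p))"
          using kA pAB by (intro mult_left_mono) auto
        ultimately have "e * p \<ge> n * (- (1 / p)) * p"
          using p by (intro mult_right_mono) auto
        then show ?thesis using p by simp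
      qed
      then have "1 \<le> (2 ^ j :: real) powr (e * p + n)" by (intro ge_one_powr_ge_zero) auto
      also have "\<dots> = ((2 ^ j) powr e) powr p * (2 ^ j) ^ n"
        by (simp add: powr_add powr_powr powr_realpow)
      finally have "K powr p * (1 / real (Suc j)) * 1
          \<le> K powr p * (1 / real (Suc j)) * (((2 ^ j) powr e) powr p * (2 ^ j) ^ n)"
        by (intro mult_left_mono) auto
      also have "\<dots> = c j powr p * (2 ^ j) ^ n"
        using K by (simp add: c_def powr_mult w)
      finally show ?thesis by simp
    qed
    have "summable (\<lambda>j. K powr p * (1 / real (Suc j)))"
      by (rule summable_comparison_test'[OF summable, where N = 0]) (use lower in simp)
    then have "summable (\<lambda>j. 1 / real (Suc j))"
      by (rule summable_mult_D) (use K in simp)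
    then show False
      using not_summable_harmonic[where 'a = real] summable_Suc_iff[of "\<lambda>j. inverse (real j)"]
      by (simp add: divide_inverse)
  qed
  moreover have "in_Lp sphere_measure q \<Omega>" "odd_on_sphere \<Omega>"
    unfolding \<Omega>_def using s q S(1) by (auto intro: in_Lp_odd_rough odd_on_sphere_odd_rough)
  moreover have "in_Lp lborel (P $ i) (f i)" for i
  proof (cases "i \<in> S")
    case True
    then have "\<bar>f i y\<bar> powr (P $ i) = indicator (cbox (\<chi> c. -1) (\<chi> c. 1)) y" for y
      by (simp add: f_def indicator_def)
    then show ?thesis
      using True integrable_real_indicator[OF _ emeasure_lborel_cbox_finite]
      by (simp add: in_Lp_def f_def)
  next
    case False
    then show ?thesis
      using in_Lp_tail_function[OF s, of "P $ i"] P[of i] by (simp add: f_def)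
  qed
  ultimately show ?thesis by blast
qed

end
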